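(* Let $u\in\mathcal{V}_0$. Assume that there are $x_1,x_2\in\mathbb{R}$ with $x_1\neq x_2$ such that $$\lim_{y\to+\infty}u(x+iy)/y=0$$ for $x=x_1$ and for $x=x_2$. Then $u(z)=0$ for all $z\in\mathbb{H}$.
   Context: $\mathbb{H}=\{z\in\mathbb{C}:\operatorname{Im} z>0\}$ is the open upper half-plane. $\mathcal{V}_0$ is the set of all functions on $\mathbb{H}$ of the form $$u(z)=\sum_{k=0}^n c_k\,(\operatorname{Im} z)\,p_{k,0}(z),\qquad p_{k,0}(z)=\sum_{j=0}^k z^{k-j}\bar z^{\,j},\quad z\in\mathbb{H},$$ for some $n\in\{0,1,2,\dots\}$ and $c_0,\dots,c_n\in\mathbb{C}$. *)

theory Defs
  imports Complex_Main
begin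

definition upper_half_plane :: "complex set" where
  "upper_half_plane = {z. Im z > 0}"

definition p0 :: "nat \<Rightarrow> complex \<Rightarrow> complex" where
  "p0 k z = (\<Sum>j=0..k. z ^ (k - j) * cnj z ^ j)"

text \<open>Functions on the half-plane are represented by total functions on the complex numbers
  whose values off the half-plane are unconstrained.\<close>

definition V0 :: "(complex \<Rightarrow> complex) set" where
  "V0 = {u. \<exists>(n::nat) (c::nat \<Rightarrow> complex). \<forall>z\<in>upper_half_plane.
              u z = (\<Sum>k=0..n. c k * of_real (Im z) * p0 k z)}"

end

theory Submission
  imports Defs "HOL-Computational_Algebra.Fundamental_Theorem_Algebra"
begin

text \<open>Put $P(z) = \sum_k c_k z^{k+1}$, so that $2i\,u(z) = P(z) - P(\bar z)$ by telescoping. On a vertical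
  line, $u(x+iy)/y$ is a polynomial in $y$ that tends to $0$, so it vanishes identically, which means
  that $P$ is symmetric about $x$. The two symmetries about $x_1$ and $x_2$ compose to a
  translation by $2(x_2-x_1)$, hence $P$ is periodic and therefore constant.\<close>

text \<open>The modulus of a nonconstant polynomial goes to infinity with the modulus of its
  argument, so a finite limit along \<open>f\<close> leaves only a constant, which must then equal
  the limit 0.\<close>

lemma poly_tendsto_zero_imp_zero:
  fixes p :: "complex poly"
  assumes f: "filterlim (\<lambda>x. cmod (f x)) at_top F" and F: "F \<noteq> bot"
    and lim: "((\<lambda>x. poly p (f x)) \<longlongrightarrow> 0) F"
  shows "p = 0"
proof (cases p)
  case (pCons a q)
  show ?thesis
  proof (cases "q = 0")
    case True
    then have "((\<lambda>_. a) \<longlongrightarrow> 0) F"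
      using lim pCons by simp
    then have "a = 0"
      using F tendsto_const_iff by blast
    with True pCons show ?thesis by simp
  next
    case False
    \<comment> \<open>Any positive bound would do in place of 1: it only has to contradict the limit
      0.\<close>
    obtain r where r: "\<And>z. r \<le> cmod z \<Longrightarrow> 1 \<le> cmod (poly p z)"
      using poly_infinity[OF False, of 1 a] pCons by blast
    have "\<forall>\<^sub>F x in F. r \<le> cmod (f x)"
      using f by (simp add: filterlim_at_top)
    moreover have "\<forall>\<^sub>F x in F. cmod (poly p (f x)) < 1"
      using lim by (auto simp: tendsto_iff dist_norm)
    ultimately have "\<forall>\<^sub>F x in F. False"
      by eventually_elim (use r in fastforce)
    with F show ?thesis by simp
  qed
qed

text \<open>In characteristic zero the multiples \<open>of_nat n * d\<close> are pairwise distinct,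
  so \<open>p\<close> takes the value \<open>poly p 0\<close> infinitely often.\<close>

lemma poly_periodic_imp_const:
  fixes p :: "'a::{idom,ring_char_0} poly"
  assumes d: "d \<noteq> 0" and per: "\<And>w. poly p (w + d) = poly p w"
  shows "poly p z = poly p 0"
proof -
  have *: "poly p (of_nat n * d) = poly p 0" for n
  proof (induction n)
    case (Suc n)
    then show ?case
      using per[of "of_nat n * d"] by (simp add: algebra_simps)
  qed simp
  have "range (\<lambda>n. of_nat n * d) \<subseteq> {w. poly (p - [:poly p 0:]) w = 0}"
    using * by auto
  moreover have "infinite (range (\<lambda>n. of_nat n * d :: 'a))"
    by (rule range_inj_infinite) (use d in \<open>auto simp: inj_def\<close>)
  ultimately have "p - [:poly p 0:] = 0"
    using poly_roots_finite finite_subset by blast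
  then have "poly (p - [:poly p 0:]) z = 0" by simp
  then show ?thesis by simp
qed

lemma diff_cnj_times_p0: "(z - cnj z) * p0 k z = z ^ Suc k - cnj z ^ Suc k"
  using power_diff_sumr2[of "cnj z" "Suc k" z]
  unfolding p0_def lessThan_Suc_atMost atLeast0AtMost
  by (simp add: algebra_simps)

text \<open>The difference of the two sides is a polynomial in \<open>w\<close> that vanishes at 0.
  Its quotient by \<open>w\<close> tends to 0 along the upper imaginary axis, hence is the zero
  polynomial; this carries the information from one ray to every complex \<open>w\<close>.\<close>

lemma poly_symmetric_about_vertical_line:
  fixes P :: "complex poly" and x :: real
  assumes lim: "((\<lambda>y::real. (poly P (of_real x + \<i> * of_real y) - poly P (of_real x - \<i> * of_real y))
                   / of_real y) \<longlongrightarrow> 0) at_top"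
  shows "poly P (of_real x + w) = poly P (of_real x - w)"
proof -
  define R where "R = pcompose P [:of_real x, 1:] - pcompose P [:of_real x, -1:]"
  have R: "poly R w = poly P (of_real x + w) - poly P (of_real x - w)" for w
    by (simp add: R_def poly_pcompose)
  obtain a S where RS: "R = pCons a S" by (cases R)
  then have "a = 0" using R[of 0] by simp
  with RS have RS: "poly R w = w * poly S w" for w by simp
  \<comment> \<open>The hypothesis divides by \<open>y\<close>, while \<open>S\<close> arises on
    dividing by \<i> times \<open>y\<close>; the extra division by \<i> makes up for this.\<close>
  have "((\<lambda>y::real. poly R (\<i> * of_real y) / of_real y / \<i>) \<longlongrightarrow> 0 / \<i>) at_top"
    unfolding R by (intro tendsto_divide lim) auto
  moreover have "\<forall>\<^sub>F y::real in at_top. poly R (\<i> * of_real y) / of_real y / \<i> = poly S (\<i> * of_real y)"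
    using eventually_gt_at_top[of 0] by eventually_elim (simp add: RS)
  ultimately have "((\<lambda>y::real. poly S (\<i> * of_real y)) \<longlongrightarrow> 0) at_top"
    by (simp add: Lim_transform_eventually)
  moreover have "filterlim (\<lambda>y::real. cmod (\<i> * of_real y)) at_top at_top"
    by (simp add: norm_mult filterlim_abs_real)
  ultimately have "S = 0"
    by (intro poly_tendsto_zero_imp_zero[of _ at_top]) auto
  then show ?thesis
    using R[of w] RS[of w] by simp
qed

theorem theorem7p1:
  fixes u :: "complex \<Rightarrow> complex" and x1 x2 :: real
  assumes "u \<in> V0"
    and "x1 \<noteq> x2"
    and "((\<lambda>y::real. u (of_real x1 + \<i> * of_real y) / of_real y) \<longlongrightarrow> 0) at_top"
    and "((\<lambda>y::real. u (of_real x2 + \<i> * of_real y) / of_real y) \<longlongrightarrow> 0) at_top"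
  shows "\<forall>z\<in>upper_half_plane. u z = 0"
proof -
  obtain n c where u: "\<And>z. z \<in> upper_half_plane \<Longrightarrow> u z = (\<Sum>k=0..n. c k * of_real (Im z) * p0 k z)"
    using assms(1) unfolding V0_def by blast
  define P where "P = (\<Sum>k=0..n. monom (c k) (Suc k))"
  have P: "poly P z = (\<Sum>k=0..n. c k * z ^ Suc k)" for z
    by (simp add: P_def poly_sum poly_monom)
  have uP: "2 * \<i> * u z = poly P z - poly P (cnj z)" if "z \<in> upper_half_plane" for z
  proof -
    \<comment> \<open>The factor 2\<i> turns \<open>Im z\<close> into \<open>z - cnj z\<close>,
      which makes \<open>p0 k z\<close> telescope.\<close>
    have "2 * \<i> * u z = (\<Sum>k=0..n. c k * ((z - cnj z) * p0 k z))"
      unfolding u[OF that] sum_distrib_left complex_diff_cnj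
      by (intro sum.cong) (simp_all add: mult_ac)
    then show ?thesis
      unfolding diff_cnj_times_p0 by (simp add: P sum_subtractf right_diff_distrib)
  qed
  have sym: "poly P (of_real x + w) = poly P (of_real x - w)"
    if lim: "((\<lambda>y::real. u (of_real x + \<i> * of_real y) / of_real y) \<longlongrightarrow> 0) at_top" for x :: real and w
  proof (rule poly_symmetric_about_vertical_line)
    have "((\<lambda>y::real. 2 * \<i> * (u (of_real x + \<i> * of_real y) / of_real y)) \<longlongrightarrow> 2 * \<i> * 0) at_top"
      by (intro tendsto_mult_left lim)
    moreover have "\<forall>\<^sub>F y::real in at_top. 2 * \<i> * (u (of_real x + \<i> * of_real y) / of_real y) =
        (poly P (of_real x + \<i> * of_real y) - poly P (of_real x - \<i> * of_real y)) / of_real y"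
      \<comment> \<open>The formula for \<open>u\<close> is available only for positive
        \<open>y\<close>. There \<open>x\<close> being real makes the second argument of
        \<open>P\<close> the conjugate of the first.\<close>
      using eventually_gt_at_top[of 0]
    proof eventually_elim
      case (elim y)
      then show ?case
        using uP[of "of_real x + \<i> * of_real y"] by (simp add: upper_half_plane_def)
    qed
    ultimately show "((\<lambda>y::real. (poly P (of_real x + \<i> * of_real y) - poly P (of_real x - \<i> * of_real y))
                   / of_real y) \<longlongrightarrow> 0) at_top"
      by (simp add: Lim_transform_eventually)
  qed
  define d :: complex where "d = 2 * (of_real x2 - of_real x1)"
  \<comment> \<open>Both sides equal \<open>poly P (2 * of_real x1 - w)\<close>: reflecting
    \<open>w\<close> about \<open>x1\<close> gives this point, and reflecting it about
    \<open>x2\<close> gives \<open>w + d\<close>.\<close>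
  have "poly P (w + d) = poly P w" for w
    using sym[OF assms(3), of "of_real x1 - w"] sym[OF assms(4), of "w + of_real x2 - 2 * of_real x1"]
    by (simp add: d_def algebra_simps)
  moreover have "d \<noteq> 0"
    using assms(2) by (simp add: d_def)
  ultimately have const: "poly P z = poly P 0" for z
    by (rule poly_periodic_imp_const[rotated])
  then have "2 * \<i> * u z = 0" if "z \<in> upper_half_plane" for z
    using uP[OF that] const[of z] const[of "cnj z"] by simp
  then show ?thesis by simp
qed

end
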